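(* Persistent order extension principle: every persistence poset $(X,\phi)$, indexed by a linearly ordered set $I$, has a linear extension.
   Context: Let $I$ be a linearly ordered set, viewed as a category. A persistence poset $(X,\phi)$ is a functor from $I$ to the category of posets and order-preserving maps, with components $X_i$ and structure maps $\phi_{ij}: X_i\to X_j$ for $i\leqslant j$. Convention: if $X_i\ne\varnothing$ and $X_j=\varnothing$ for some $i<j$, so that no function $X_i \to X_j$ exists, one formally sets $\phi_{ij}=\bot$ and ignores it in all conditions involving structure maps. An extension of a persistence poset $(X,\phi)$ is a family of partial orders, one on the underlying set of each $X_i$, each containing the given order of $X_i$, such that all the structure maps $\phi_{ij}$ remain order-preserving (with respect to the new orders; i.e. $a\leqslant b$ implies $\phi_{ij}(a)\leqslant\phi_{ij}(b)$). The extension is called linear if the order on every component is a total order. *)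

theory Defs
  imports Main
begin

text \<open>
  A linearly ordered set is a carrier \<open>I\<close> with a relation \<open>L\<close> such that \<^term>\<open>linear_order_on I L\<close>.
  A poset is a carrier \<open>X i\<close> with a relation \<open>R i\<close> such that \<^term>\<open>partial_order_on (X i) (R i)\<close>.
  Structure maps are HOL functions, of which only the values on the respective carrier matter.

  \<open>structure_map_exists X i j\<close> fails exactly if there is no function from \<open>X i\<close> to \<open>X j\<close>, i.e. if
  by convention the structure map is \<open>\<bottom>\<close>. The term \<open>\<phi> i j\<close> then denotes an arbitrary function,
  and every condition that involves it is dropped.
\<close>

definition structure_map_exists :: "('i \<Rightarrow> 'a set) \<Rightarrow> 'i \<Rightarrow> 'i \<Rightarrow> bool" where
  "structure_map_exists X i j \<longleftrightarrow> \<not> (X i \<noteq> {} \<and> X j = {})"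

definition order_preserving :: "'a rel \<Rightarrow> 'b rel \<Rightarrow> ('a \<Rightarrow> 'b) \<Rightarrow> bool" where
  "order_preserving r s f \<longleftrightarrow> (\<forall>a b. (a, b) \<in> r \<longrightarrow> (f a, f b) \<in> s)"

definition persistence_poset ::
  "'i set \<Rightarrow> 'i rel \<Rightarrow> ('i \<Rightarrow> 'a set) \<Rightarrow> ('i \<Rightarrow> 'a rel) \<Rightarrow> ('i \<Rightarrow> 'i \<Rightarrow> 'a \<Rightarrow> 'a) \<Rightarrow> bool" where
  "persistence_poset I L X R \<phi> \<longleftrightarrow>
     (\<forall>i\<in>I. partial_order_on (X i) (R i)) \<and>
     (\<forall>i j. (i, j) \<in> L \<longrightarrow> structure_map_exists X i j \<longrightarrow>
        \<phi> i j ` X i \<subseteq> X j \<and> order_preserving (R i) (R j) (\<phi> i j)) \<and>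
     (\<forall>i\<in>I. \<forall>x\<in>X i. \<phi> i i x = x) \<and>
     (\<forall>i j k. (i, j) \<in> L \<longrightarrow> (j, k) \<in> L \<longrightarrow>
        structure_map_exists X i j \<longrightarrow> structure_map_exists X j k \<longrightarrow> structure_map_exists X i k \<longrightarrow>
        (\<forall>x\<in>X i. \<phi> j k (\<phi> i j x) = \<phi> i k x))"

definition extension ::
  "'i set \<Rightarrow> 'i rel \<Rightarrow> ('i \<Rightarrow> 'a set) \<Rightarrow> ('i \<Rightarrow> 'a rel) \<Rightarrow> ('i \<Rightarrow> 'i \<Rightarrow> 'a \<Rightarrow> 'a) \<Rightarrow> ('i \<Rightarrow> 'a rel) \<Rightarrow> bool" where
  "extension I L X R \<phi> S \<longleftrightarrow>
     (\<forall>i\<in>I. partial_order_on (X i) (S i) \<and> R i \<subseteq> S i) \<and>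
     (\<forall>i j. (i, j) \<in> L \<longrightarrow> structure_map_exists X i j \<longrightarrow> order_preserving (S i) (S j) (\<phi> i j))"

definition linear_extension ::
  "'i set \<Rightarrow> 'i rel \<Rightarrow> ('i \<Rightarrow> 'a set) \<Rightarrow> ('i \<Rightarrow> 'a rel) \<Rightarrow> ('i \<Rightarrow> 'i \<Rightarrow> 'a \<Rightarrow> 'a) \<Rightarrow> ('i \<Rightarrow> 'a rel) \<Rightarrow> bool" where
  "linear_extension I L X R \<phi> S \<longleftrightarrow>
     extension I L X R \<phi> S \<and> (\<forall>i\<in>I. linear_order_on (X i) (S i))"

end

theory Submission
  imports Defs
begin

text \<open>
  Zorn's lemma yields a maximal extension. If \<open>x\<close> and \<open>y\<close> were incomparable in the \<open>i\<close>-th component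
  of it, one of the relations \<open>x \<le> y\<close> and \<open>y \<le> x\<close> could be added: the images of \<open>x\<close> and \<open>y\<close> cannot
  become strictly ordered one way at some later index and the other way at another one, because the
  map from the earlier to the later of the two is order-preserving. Hence one of the two relations is
  consistent with all images, and adding all its images enlarges the extension.
\<close>

text \<open>For a preorder \<open>r\<close> on a set containing \<open>x\<close> and
  \<open>y\<close>, this is the transitive closure of \<open>insert (x, y) r\<close>, in closed
  form: a path needs the new pair at most once.\<close>

definition add_pair :: "'a rel \<Rightarrow> 'a \<Rightarrow> 'a \<Rightarrow> 'a rel" where
  "add_pair r x y = r \<union> {(a, b). (a, x) \<in> r \<and> (y, b) \<in> r}"

text \<open>The hypothesis allows \<open>x = y\<close>, since a structure map may identify the two
  elements; in that case nothing new is added.\<close>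

lemma partial_order_on_add_pair:
  assumes r: "partial_order_on A r" and xy: "(y, x) \<in> r \<Longrightarrow> x = y"
  shows "partial_order_on A (add_pair r x y)"
proof -
  have refl: "refl_on A r" and sub: "r \<subseteq> A \<times> A" and "trans r" and "antisym r"
    using r by (auto simp: partial_order_on_def preorder_on_def)
  have tr: "\<And>a b c. (a, b) \<in> r \<Longrightarrow> (b, c) \<in> r \<Longrightarrow> (a, c) \<in> r"
    using \<open>trans r\<close> by (blast dest: transD)
  have as: "\<And>a b. (a, b) \<in> r \<Longrightarrow> (b, a) \<in> r \<Longrightarrow> a = b"
    using \<open>antisym r\<close> by (blast dest: antisymD)
  have "trans (add_pair r x y)"
    by (rule transI) (unfold add_pair_def, blast intro: tr)
  moreover have "antisym (add_pair r x y)"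
  proof (rule antisymI)
    fix a b assume ab: "(a, b) \<in> add_pair r x y" "(b, a) \<in> add_pair r x y"
    \<comment> \<open>If at least one of the two pairs is new, a walk from \<open>y\<close> through
      \<open>a\<close> or \<open>b\<close> to \<open>x\<close> stays inside \<open>r\<close>. Then
      \<open>x = y\<close>, so the new pairs were in \<open>r\<close> already.\<close>
    have "(a, b) \<in> r \<and> (b, a) \<in> r \<or> (y, x) \<in> r"
      using ab unfolding add_pair_def by (blast intro: tr)
    then show "a = b"
      using ab xy unfolding add_pair_def by (blast intro: as tr)
  qed
  moreover have "refl_on A (add_pair r x y)" "add_pair r x y \<subseteq> A \<times> A"
    using refl sub by (auto simp: add_pair_def refl_on_def)
  ultimately show ?thesis
    by (simp add: partial_order_on_def preorder_on_def)
qed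

lemma order_preserving_add_pair:
  assumes "order_preserving r s f"
  shows "order_preserving (add_pair r x y) (add_pair s (f x) (f y)) f"
  using assms by (auto simp: order_preserving_def add_pair_def)

lemma partial_order_on_Union_chain:
  assumes "C \<noteq> {}" and chain: "\<And>r s. r \<in> C \<Longrightarrow> s \<in> C \<Longrightarrow> r \<subseteq> s \<or> s \<subseteq> r"
    and po: "\<And>r. r \<in> C \<Longrightarrow> partial_order_on A r"
  shows "partial_order_on A (\<Union>C)"
proof -
  \<comment> \<open>Transitivity and antisymmetry each involve two pairs, so the larger of two
    members of the chain decides them.\<close>
  have common: "\<exists>t\<in>C. p \<in> t \<and> q \<in> t" if "p \<in> \<Union>C" "q \<in> \<Union>C" for p q
    using that chain by blast
  have "trans (\<Union>C)"
  proof (rule transI)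
    fix a b c assume "(a, b) \<in> \<Union>C" "(b, c) \<in> \<Union>C"
    then obtain t where "t \<in> C" "(a, b) \<in> t" "(b, c) \<in> t"
      using common by blast
    then show "(a, c) \<in> \<Union>C"
      using po[of t] by (auto simp: partial_order_on_def preorder_on_def dest: transD)
  qed
  moreover have "antisym (\<Union>C)"
  proof (rule antisymI)
    fix a b assume "(a, b) \<in> \<Union>C" "(b, a) \<in> \<Union>C"
    then obtain t where "t \<in> C" "(a, b) \<in> t" "(b, a) \<in> t"
      using common by blast
    then show "a = b"
      using po[of t] by (auto simp: partial_order_on_def dest: antisymD)
  qed
  moreover have "refl_on A (\<Union>C)" "\<Union>C \<subseteq> A \<times> A"
    using po \<open>C \<noteq> {}\<close> unfolding partial_order_on_def preorder_on_def refl_on_def by blast+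
  ultimately show ?thesis
    by (simp add: partial_order_on_def preorder_on_def)
qed

text \<open>Structure maps carry the images of \<open>x\<close> and \<open>y\<close> to their images
  further on, so new pairs go to new pairs. A map starting at an index not above \<open>i\<close>
  has an unchanged source and a target that can only grow. The hypothesis \<open>consistent\<close>
  secures antisymmetry in each component.\<close>

lemma extension_add_images:
  assumes L: "linear_order_on I L" and P: "persistence_poset I L X R \<phi>"
    and S: "extension I L X R \<phi> S"
    and x: "x \<in> X i" and y: "y \<in> X i"
    and consistent: "\<And>j. (i, j) \<in> L \<Longrightarrow> X j \<noteq> {} \<Longrightarrow> (\<phi> i j y, \<phi> i j x) \<in> S j \<Longrightarrow> \<phi> i j x = \<phi> i j y"
  shows "extension I L X R \<phi>
    (\<lambda>j. if (i, j) \<in> L then add_pair (S j) (\<phi> i j x) (\<phi> i j y) else S j)"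
    (is "extension I L X R \<phi> ?S'")
proof -
  have LI: "L \<subseteq> I \<times> I" and "trans L"
    using L by (auto simp: linear_order_on_def partial_order_on_def preorder_on_def)
  have po: "partial_order_on (X j) (S j)" and RS: "R j \<subseteq> S j" if "j \<in> I" for j
    using S that by (auto simp: extension_def)
  have mono: "order_preserving (S j) (S k) (\<phi> j k)"
    if "(j, k) \<in> L" "structure_map_exists X j k" for j k
    using S that by (auto simp: extension_def)
  have sub: "S j \<subseteq> ?S' j" for j
    by (auto simp: add_pair_def)
  have po': "partial_order_on (X j) (?S' j)" if "j \<in> I" for j
  proof (cases "(i, j) \<in> L")
    case True
    have "\<phi> i j x = \<phi> i j y" if *: "(\<phi> i j y, \<phi> i j x) \<in> S j"
    proof (rule consistent[OF True _ *])
      show "X j \<noteq> {}"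
        using * po[OF \<open>j \<in> I\<close>] by (auto simp: partial_order_on_def preorder_on_def)
    qed
    with True show ?thesis
      using partial_order_on_add_pair[OF po[OF \<open>j \<in> I\<close>]] by simp
  qed (simp add: po that)
  have mono': "order_preserving (?S' j) (?S' k) (\<phi> j k)"
    if jk: "(j, k) \<in> L" and ex: "structure_map_exists X j k" for j k
  proof (cases "(i, j) \<in> L")
    case True
    then have ik: "(i, k) \<in> L"
      using jk \<open>trans L\<close> by (blast dest: transD)
    show ?thesis
    \<comment> \<open>Over an empty component \<open>\<phi> i j\<close> is arbitrary and
      functoriality says nothing about it, but there the relation has no pairs to preserve.\<close>
    proof (cases "X j = {}")
      case True
      have "?S' j \<subseteq> X j \<times> X j"
        using po'[of j] jk LI unfolding partial_order_on_def preorder_on_def by blast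
      with True show ?thesis
        by (auto simp: order_preserving_def)
    next
      case False
      then have "X k \<noteq> {}"
        using ex by (simp add: structure_map_exists_def)
      then have "\<phi> j k (\<phi> i j z) = \<phi> i k z" if "z \<in> X i" for z
        using P True jk False that
        unfolding persistence_poset_def structure_map_exists_def by blast
      then show ?thesis
        using order_preserving_add_pair[OF mono[OF jk ex], of "\<phi> i j x" "\<phi> i j y"] True ik x y
        by simp
    qed
  next
    case False
    then show ?thesis
      using mono[OF jk ex] sub[of k] unfolding order_preserving_def by (simp only: if_False) blast
  qed
  show ?thesis
    unfolding extension_def using po' mono' RS sub by (meson subset_trans)
qed

text \<open>Both comparisons are pushed to the later of \<open>j\<close> and \<open>k\<close>. At
  \<open>k\<close>, antisymmetry gives the claim; at \<open>j\<close>, it contradicts the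
  distinctness of the images. The conclusion has the shape of the hypothesis
  \<open>consistent\<close> above with \<open>x\<close> and \<open>y\<close> exchanged.\<close>

lemma consistent_direction:
  assumes L: "linear_order_on I L" and P: "persistence_poset I L X R \<phi>"
    and S: "extension I L X R \<phi> S"
    and x: "x \<in> X i" and y: "y \<in> X i"
    and j: "(i, j) \<in> L" "X j \<noteq> {}" "(\<phi> i j y, \<phi> i j x) \<in> S j" "\<phi> i j x \<noteq> \<phi> i j y"
    and k: "(i, k) \<in> L" "X k \<noteq> {}" "(\<phi> i k x, \<phi> i k y) \<in> S k"
  shows "\<phi> i k x = \<phi> i k y"
proof -
  have LI: "L \<subseteq> I \<times> I" and "refl_on I L" and "total_on I L"
    using L by (auto simp: linear_order_on_def partial_order_on_def preorder_on_def)
  have push: "(\<phi> i n a, \<phi> i n b) \<in> S n"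
    if "(i, m) \<in> L" "(m, n) \<in> L" "X m \<noteq> {}" "X n \<noteq> {}" "a \<in> X i" "b \<in> X i"
      "(\<phi> i m a, \<phi> i m b) \<in> S m" for m n a b
  proof -
    have ex: "structure_map_exists X i m" "structure_map_exists X m n" "structure_map_exists X i n"
      using that by (auto simp: structure_map_exists_def)
    then have "\<phi> m n (\<phi> i m z) = \<phi> i n z" if "z \<in> X i" for z
      using P that \<open>(i, m) \<in> L\<close> \<open>(m, n) \<in> L\<close> unfolding persistence_poset_def by blast
    moreover have "order_preserving (S m) (S n) (\<phi> m n)"
      using S ex that unfolding extension_def by blast
    ultimately show ?thesis
      using that unfolding order_preserving_def by metis
  qed
  have as: "a = b" if "n \<in> I" "(a, b) \<in> S n" "(b, a) \<in> S n" for a b n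
    using S that unfolding extension_def partial_order_on_def by (blast dest: antisymD)
  have "j \<in> I" "k \<in> I"
    using j k LI by auto
  then consider "(j, k) \<in> L" | "(k, j) \<in> L"
    using \<open>refl_on I L\<close> \<open>total_on I L\<close> unfolding refl_on_def total_on_def by metis
  then show ?thesis
  proof cases
    case 1
    then show ?thesis
      using push[OF j(1) 1 j(2) k(2) y x j(3)] k as[OF \<open>k \<in> I\<close>] by blast
  next
    case 2
    then show ?thesis
      using push[OF k(1) 2 k(2) j(2) x y k(3)] j as[OF \<open>j \<in> I\<close>] by blast
  qed
qed

text \<open>Zorn's lemma applies: \<open>R\<close> is an extension of itself, and unions of nonempty
  chains stay extensions. Reflexivity and containing \<open>R\<close> survive enlargement, and the
  other conditions start from at most two related pairs.\<close>

lemma exists_maximal_extension: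
  fixes I :: "'i set" and X :: "'i \<Rightarrow> 'a set"
  assumes P: "persistence_poset I L X R \<phi>" and LI: "L \<subseteq> I \<times> I"
  obtains S where "extension I L X R \<phi> S"
    and "\<And>S' i. extension I L X R \<phi> S' \<Longrightarrow> (\<And>j. S j \<subseteq> S' j) \<Longrightarrow> S' i = S i"
proof -
  \<comment> \<open>A family of relations is encoded as the set of pairs of an index and a related pair, so that
    the pointwise order on families becomes inclusion of sets.\<close>
  define E where "E = {T :: ('i \<times> 'a \<times> 'a) set. extension I L X R \<phi> (\<lambda>i. T `` {i})}"
  have Sigma_E: "Sigma UNIV S \<in> E \<longleftrightarrow> extension I L X R \<phi> S" for S
    by (simp add: E_def Image_def)
  have "extension I L X R \<phi> R"
    using P by (simp add: extension_def persistence_poset_def)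
  then have "E \<noteq> {}"
    using Sigma_E by blast
  moreover have "\<Union>C \<in> E" if "C \<noteq> {}" and chain: "subset.chain E C" for C
  proof -
    have CE: "\<And>T. T \<in> C \<Longrightarrow> extension I L X R \<phi> (\<lambda>i. T `` {i})"
      using chain by (auto simp: subset_chain_def E_def)
    have "partial_order_on (X i) (\<Union>C `` {i})" if "i \<in> I" for i
    proof -
      have "partial_order_on (X i) (\<Union>((\<lambda>T. T `` {i}) ` C))"
      proof (rule partial_order_on_Union_chain)
        fix r s assume "r \<in> (\<lambda>T. T `` {i}) ` C" "s \<in> (\<lambda>T. T `` {i}) ` C"
        then obtain T U where "T \<in> C" "U \<in> C" "r = T `` {i}" "s = U `` {i}"
          by blast
        moreover from this have "T \<subseteq> U \<or> U \<subseteq> T"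
          using chain by (auto simp: subset_chain_def)
        ultimately show "r \<subseteq> s \<or> s \<subseteq> r"
          by blast
      qed (use \<open>C \<noteq> {}\<close> CE \<open>i \<in> I\<close> in \<open>auto simp: extension_def\<close>)
      moreover have "\<Union>C `` {i} = \<Union>((\<lambda>T. T `` {i}) ` C)"
        by blast
      ultimately show ?thesis
        by simp
    qed
    moreover have "R i \<subseteq> \<Union>C `` {i}" if "i \<in> I" for i
      using \<open>C \<noteq> {}\<close> CE that unfolding extension_def by blast
    moreover have "order_preserving (\<Union>C `` {i}) (\<Union>C `` {j}) (\<phi> i j)"
      if "(i, j) \<in> L" "structure_map_exists X i j" for i j
      using CE that unfolding extension_def order_preserving_def by blast
    ultimately show ?thesis
      by (simp add: E_def extension_def)
  qed
  ultimately obtain M where M: "M \<in> E" and max: "\<And>T. T \<in> E \<Longrightarrow> M \<subseteq> T \<Longrightarrow> T = M"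
    using subset_Zorn_nonempty[of E] by blast
  show thesis
  proof
    show "extension I L X R \<phi> (\<lambda>i. M `` {i})"
      using M by (simp add: E_def)
    fix S' i assume "extension I L X R \<phi> S'" and "\<And>j. M `` {j} \<subseteq> S' j"
    then have "Sigma UNIV S' = M"
      by (intro max) (auto simp: Sigma_E)
    then show "S' i = M `` {i}"
      by blast
  qed
qed

theorem proposition18:
  fixes I :: "'i set" and L :: "'i rel"
    and X :: "'i \<Rightarrow> 'a set" and R :: "'i \<Rightarrow> 'a rel"
    and \<phi> :: "'i \<Rightarrow> 'i \<Rightarrow> 'a \<Rightarrow> 'a"
  assumes "linear_order_on I L"
    and "persistence_poset I L X R \<phi>"
  shows "\<exists>S. linear_extension I L X R \<phi> S"
proof -
  have LI: "L \<subseteq> I \<times> I" and "refl_on I L"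
    using assms(1) by (auto simp: linear_order_on_def partial_order_on_def preorder_on_def)
  obtain S where S: "extension I L X R \<phi> S"
    and max: "\<And>S' i. extension I L X R \<phi> S' \<Longrightarrow> (\<And>j. S j \<subseteq> S' j) \<Longrightarrow> S' i = S i"
    using exists_maximal_extension[OF assms(2) LI] by blast
  \<comment> \<open>By maximality, adding the images of a consistent pair changes nothing. At
    \<open>i\<close> itself, where \<open>\<phi> i i\<close> is the identity on \<open>X i\<close>,
    the pair added is \<open>(x, y)\<close>.\<close>
  have consistent_imp_le: "(x, y) \<in> S i"
    if i: "i \<in> I" and xy: "x \<in> X i" "y \<in> X i"
      and consistent: "\<And>j. (i, j) \<in> L \<Longrightarrow> X j \<noteq> {} \<Longrightarrow> (\<phi> i j y, \<phi> i j x) \<in> S j \<Longrightarrow> \<phi> i j x = \<phi> i j y"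
    for i x y
  proof -
    let ?S' = "\<lambda>j. if (i, j) \<in> L then add_pair (S j) (\<phi> i j x) (\<phi> i j y) else S j"
    have "extension I L X R \<phi> ?S'"
      by (rule extension_add_images[OF assms S xy consistent])
    moreover have "S j \<subseteq> ?S' j" for j
      by (auto simp: add_pair_def)
    ultimately have "?S' i = S i"
      by (rule max)
    moreover have "(i, i) \<in> L"
      using \<open>refl_on I L\<close> i by (auto simp: refl_on_def)
    moreover have "\<phi> i i x = x" "\<phi> i i y = y"
      using assms(2) i xy by (auto simp: persistence_poset_def)
    moreover have "(x, x) \<in> S i" "(y, y) \<in> S i"
      using S i xy by (auto simp: extension_def partial_order_on_def preorder_on_def refl_on_def)
    ultimately show ?thesis
      by (auto simp: add_pair_def)
  qed
  have "total_on (X i) (S i)" if i: "i \<in> I" for i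
  proof (rule total_onI)
    fix x y assume xy: "x \<in> X i" "y \<in> X i"
    show "(x, y) \<in> S i \<or> (y, x) \<in> S i"
    \<comment> \<open>A strict comparison of the images at one index fixes the direction to add; if
      none puts \<open>y\<close> below \<open>x\<close>, the direction from \<open>x\<close> to
      \<open>y\<close> is consistent outright.\<close>
    proof (cases "\<exists>j. (i, j) \<in> L \<and> X j \<noteq> {} \<and> (\<phi> i j y, \<phi> i j x) \<in> S j \<and> \<phi> i j x \<noteq> \<phi> i j y")
      case True
      then have "(y, x) \<in> S i"
        using consistent_direction[OF assms S xy]
        by (intro consistent_imp_le[OF i xy(2,1)]) metis
      then show ?thesis ..
    next
      case False
      then have "(x, y) \<in> S i"
        by (intro consistent_imp_le[OF i xy]) blast
      then show ?thesis ..
    qed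
  qed
  then show ?thesis
    using S unfolding linear_extension_def linear_order_on_def extension_def by blast
qed

end
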